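(* Let $k \ge 1$ and let $S = \{j_1, j_2, \ldots, j_k\}$ be a set of $k$ distinct positive integers (the numbers of cookies in $k$ jars). Then $\mathrm{CM}(S) \ge \lceil \log_2(k+1) \rceil$; that is, at least $\lceil \log_2(k+1)\rceil$ moves are needed to empty all $k$ jars.
   Context: A set $S = \{j_1 < j_2 < \cdots < j_k\}$ of distinct positive integers represents $k$ jars, where the $i$-th jar initially contains $j_i$ cookies. A move consists of choosing any subset of the jars and a positive integer $a$, such that every chosen jar currently contains at least $a$ cookies, and removing exactly $a$ cookies from each chosen jar (the same number from each). The Cookie Monster number $\mathrm{CM}(S)$ is the minimum number of moves needed to empty all of the jars. *)

theory Defs
  imports Complex_Main
begin

text \<open>
  Jars are named by their initial number of cookies, which is legitimate because the elements of
  \<open>S\<close> are distinct. A configuration \<open>c\<close> maps each jar \<open>j \<in> S\<close> to its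
  current number of cookies; values outside \<open>S\<close> are irrelevant.
\<close>

definition cm_move :: "nat set \<Rightarrow> (nat \<Rightarrow> nat) \<Rightarrow> (nat \<Rightarrow> nat) \<Rightarrow> bool" where
  "cm_move S c c' \<longleftrightarrow>
     (\<exists>T a. T \<subseteq> S \<and> 0 < a \<and> (\<forall>j\<in>T. a \<le> c j) \<and>
            c' = (\<lambda>j. if j \<in> T then c j - a else c j))"

text \<open>The initial configuration is the identity: jar \<open>j\<close> contains \<open>j\<close> cookies.\<close>

definition can_empty_in :: "nat set \<Rightarrow> nat \<Rightarrow> bool" where
  "can_empty_in S n \<longleftrightarrow> (\<exists>c. (cm_move S ^^ n) (\<lambda>j. j) c \<and> (\<forall>j\<in>S. c j = 0))"

definition CM :: "nat set \<Rightarrow> nat" where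
  "CM S = (LEAST n. can_empty_in S n)"

text \<open>
  The minimum is attained for every finite set of positive integers: emptying the jars one by one
  takes \<open>card S\<close> moves.
\<close>

lemma can_empty_in_card:
  assumes "finite S" and "0 \<notin> S"
  shows "can_empty_in S (card S)"
proof -
  have "(cm_move S ^^ card A) (\<lambda>j. j) (\<lambda>j. if j \<in> A then 0 else j)"
    if "finite A" "A \<subseteq> S" for A
    using that
  proof (induction A rule: finite_induct)
    case empty
    then show ?case by simp
  next
    case (insert x A)
    have "0 < x" using insert.prems assms(2) by (cases x) auto
    then have "cm_move S (\<lambda>j. if j \<in> A then 0 else j) (\<lambda>j. if j \<in> insert x A then 0 else j)"
      unfolding cm_move_def using insert.prems insert.hyps
      by (intro exI[of _ "{x}"] exI[of _ x]) auto
    with insert show ?case by auto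
  qed
  from this[OF assms(1) order_refl] show ?thesis
    unfolding can_empty_in_def by (intro exI conjI) auto
qed

lemma can_empty_in_CM:
  assumes "finite S" and "0 \<notin> S"
  shows "can_empty_in S (CM S)"
  unfolding CM_def by (rule LeastI) (rule can_empty_in_card[OF assms])

end

theory Submission imports Defs begin

text \<open>
  A move can at most halve the number of distinct cookie counts, where the count \<open>0\<close> of
  an imaginary empty jar is always included: if a move removes \<open>a\<close> cookies from the chosen
  jars, each jar held before the move either its new count or its new count plus \<open>a\<close>, so
  the old counts lie in the union of the set of new counts and its translate by \<open>a\<close>
  (\<open>card_counts_move\<close>). Initially the \<open>k\<close> jars and the imaginary one show
  \<open>k + 1\<close> distinct counts, and in the end \<open>0\<close> is the only one; hence
  \<open>k + 1 \<le> 2 ^ n\<close> whenever \<open>n\<close> moves suffice. Taking logarithms for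
  the optimal \<open>n\<close> gives the bound.
\<close>

definition counts :: "nat set \<Rightarrow> (nat \<Rightarrow> nat) \<Rightarrow> nat set" where
  "counts S c = insert 0 (c ` S)"

text \<open>
  The imaginary jar belongs to the untouched ones, so its count \<open>0\<close> is covered by the
  untranslated copy of the new counts. This is what yields \<open>k + 1\<close> instead of
  \<open>k\<close> in the final bound.
\<close>

lemma card_counts_move:
  assumes "finite S" and "cm_move S c c'"
  shows "card (counts S c) \<le> 2 * card (counts S c')"
proof -
  obtain T a where T: "\<forall>j\<in>T. a \<le> c j"
    and c': "c' = (\<lambda>j. if j \<in> T then c j - a else c j)"
    using assms(2) unfolding cm_move_def by blast
  have fin: "finite (counts S c')"
    using assms(1) by (simp add: counts_def)
  have "c j = c' j \<or> c j = c' j + a" for j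
    using T by (auto simp: c')
  then have "counts S c \<subseteq> counts S c' \<union> (\<lambda>v. v + a) ` counts S c'"
    unfolding counts_def by blast
  then have "card (counts S c) \<le> card (counts S c' \<union> (\<lambda>v. v + a) ` counts S c')"
    using fin by (intro card_mono) auto
  also have "\<dots> \<le> card (counts S c') + card ((\<lambda>v. v + a) ` counts S c')"
    by (rule card_Un_le)
  also have "\<dots> \<le> 2 * card (counts S c')"
    using card_image_le[OF fin, of "\<lambda>v. v + a"] by linarith
  finally show ?thesis .
qed

lemma card_counts_moves:
  assumes "finite S" and "(cm_move S ^^ n) c c'"
  shows "card (counts S c) \<le> 2 ^ n * card (counts S c')"
  using assms(2)
proof (induction n arbitrary: c')
  case 0
  then show ?case by simp
next
  case (Suc n)
  then obtain d where d: "(cm_move S ^^ n) c d" "cm_move S d c'"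
    by auto
  have "card (counts S c) \<le> 2 ^ n * card (counts S d)"
    by (rule Suc.IH[OF d(1)])
  also have "\<dots> \<le> 2 ^ n * (2 * card (counts S c'))"
    by (rule mult_left_mono[OF card_counts_move[OF assms(1) d(2)]]) simp
  finally show ?case by simp
qed

lemma can_empty_in_imp_card_le:
  assumes "finite S" and "0 \<notin> S" and "can_empty_in S n"
  shows "card S + 1 \<le> 2 ^ n"
proof -
  obtain c where c: "(cm_move S ^^ n) (\<lambda>j. j) c" "\<forall>j\<in>S. c j = 0"
    using assms(3) unfolding can_empty_in_def by blast
  have "counts S c = {0}"
    using c(2) by (auto simp: counts_def)
  moreover have "card (counts S (\<lambda>j. j)) = card S + 1"
    using assms(1,2) by (simp add: counts_def)
  ultimately show ?thesis
    using card_counts_moves[OF assms(1) c(1)] by simp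
qed

theorem theorem1:
  fixes S :: "nat set" and k :: nat
  assumes "1 \<le> k" and "finite S" and "card S = k" and "\<forall>j\<in>S. 0 < j"
  shows "\<lceil>log 2 (real k + 1)\<rceil> \<le> int (CM S)"
proof -
  have "0 \<notin> S"
    using assms(4) by blast
  then have "k + 1 \<le> 2 ^ CM S"
    using can_empty_in_imp_card_le can_empty_in_CM assms(2,3) by blast
  then have "log 2 (real (k + 1)) \<le> real (CM S)"
    by (rule log2_of_power_le) simp
  then show ?thesis
    by (simp add: ceiling_le_iff add.commute)
qed

end
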